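(* For each number of rounds $T\ge1$, run FedDrop from a fixed initial vector $\boldsymbol{w}^{(0)}\in\mathbb{R}^d$ with learning rate $\eta=\frac{1}{3\sqrt{T}L}$: $$\boldsymbol{w}^{(t+1)}=\boldsymbol{w}^{(t)}-\eta\sum_{k=1}^K\frac{|\mathcal{D}_k|}{|\mathcal{D}|}\hat{\boldsymbol{g}}_k(\hat{\boldsymbol{w}}_k^{(t)}),\qquad t=0,\dots,T-1,$$ with dropout rates $\gamma_{k,t}\in[0,\theta)$ for a fixed $\theta<1$. Assume: (i) $\|\boldsymbol{H}(\boldsymbol{w})\|_F^2\le A^2$ for all $\boldsymbol{w}$; (ii) $\mathbb{E}[\|\boldsymbol{w}^{(t)}\|^2]\le G^2$ for all iterates (for every $T$ and $t$); (iii) $\mathcal{F}(\boldsymbol{w})\ge\mathcal{F}^*$ for all $\boldsymbol{w}$; (iv) $\mathcal{F}$ is $L$-smooth, i.e. $\mathcal{F}(\boldsymbol{v})\le\mathcal{F}(\boldsymbol{w})+(\boldsymbol{v}-\boldsymbol{w})^\top\nabla\mathcal{F}(\boldsymbol{w})+\frac{L}{2}\|\boldsymbol{v}-\boldsymbol{w}\|^2$ for all $\boldsymbol{v},\boldsymbol{w}$, with $L>0$; (v) the stochastic gradients $\tilde{\boldsymbol{g}}_k(\boldsymbol{w})$, $k=1,\dots,K$, are independent, with $\mathbb{E}[\tilde{\boldsymbol{g}}_k(\boldsymbol{w})]=\boldsymbol{g}(\boldsymbol{w})$ and $\mathbb{E}[\|\tilde{\boldsymbol{g}}_k(\boldsymbol{w})-\boldsymbol{g}(\boldsymbol{w})\|^2]\le\frac{\sigma^2}{|\mathcal{D}_k|}$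 for all $k$. Then $$\lim_{T\to+\infty}\frac1T\sum_{t=0}^{T-1}\mathbb{E}\left[\|\boldsymbol{g}(\boldsymbol{w}^{(t)})\|^2\right]\le G_T,$$ where $$G_T=\lim_{T\to+\infty}\frac{1}{\sqrt{T}}\left\{9L\left[\mathcal{F}(\boldsymbol{w}^{(0)})-\mathcal{F}^*\right]+2K\frac{\sigma^2}{|\mathcal{D}|}+\frac{A^2G^2}{T}\sum_{t=0}^{T-1}\sum_{k=1}^K\frac{|\mathcal{D}_k|}{|\mathcal{D}|}\frac{\gamma_{k,t}}{1-\gamma_{k,t}}\right\}=0.$$
   Context: There are $K$ devices; device $k$ has a local dataset of size $|\mathcal{D}_k|\geq 1$ and $|\mathcal{D}|=\sum_{k=1}^K|\mathcal{D}_k|$. $\mathcal{F}:\mathbb{R}^d\to\mathbb{R}$ is the (twice differentiable) global loss function, $\boldsymbol{g}(\boldsymbol{w})=\nabla\mathcal{F}(\boldsymbol{w})$ its ground-truth gradient, and $\boldsymbol{H}(\boldsymbol{w})$ its Hessian. $\sigma^2$ is the per-sample gradient variance. The constants $K,|\mathcal{D}_k|,L,A,G,\sigma^2,\mathcal{F}^*,\theta$ do not depend on $T$; the dropout rates are deterministic. $\|\cdot\|$ is the Euclidean norm, $\|\cdot\|_F$ the Frobenius norm, $\circ$ the element-wise product. Dropout: the subnet of device $k$ in round $t$ is $\hat{\boldsymbol{w}}_k^{(t)}=\boldsymbol{w}^{(t)}\circ\boldsymbol{m}_k^{(t)}$, where each entry of the random mask $\boldsymbol{m}_k^{(t)}\in\mathbb{R}^d$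 equals $\frac{1}{1-\gamma_{k,t}}$ with probability $1-\gamma_{k,t}$ and $0$ with probability $\gamma_{k,t}$. $\tilde{\boldsymbol{g}}_k(\boldsymbol{w}^{(t)})$ is the stochastic gradient of the full network at device $k$, and the subnet's gradient vector is given by its first-order Taylor expansion $$\hat{\boldsymbol{g}}_k(\hat{\boldsymbol{w}}_k^{(t)})=\tilde{\boldsymbol{g}}_k(\boldsymbol{w}^{(t)})+\boldsymbol{H}(\boldsymbol{w}^{(t)})(\hat{\boldsymbol{w}}_k^{(t)}-\boldsymbol{w}^{(t)}).$$ In each round, conditionally on $\boldsymbol{w}^{(t)}$, fresh masks $\boldsymbol{m}_k^{(t)}$, $k=1,\dots,K$ (each entry of $\boldsymbol{m}_k^{(t)}$ being equal to $\frac{1}{1-\gamma_{k,t}}$ with conditional probability $1-\gamma_{k,t}$ and to $0$ with conditional probability $\gamma_{k,t}$) and fresh stochastic gradients satisfying (v) at $\boldsymbol{w}=\boldsymbol{w}^{(t)}$ are drawn, masks independently of stochastic gradients. $\mathbb{E}$ in the conclusion is total expectation. The iterates $\boldsymbol{w}^{(t)}$ (and possibly the dropout rates) depend on $T$; this dependence is suppressed in the notation. *)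

theory Defs
  imports "HOL-Probability.Probability"
begin

definition frobenius_norm :: "real ^ 'n ^ 'm \<Rightarrow> real" where
  "frobenius_norm B = sqrt (\<Sum>i\<in>UNIV. \<Sum>j\<in>UNIV. (B $ i $ j)\<^sup>2)"

text \<open>The product \<open>w * m\<close> on \<^typ>\<open>real ^ 'd\<close> is the library's componentwise product.\<close>

definition subnet :: "real ^ 'd \<Rightarrow> real ^ 'd \<Rightarrow> real ^ 'd" where
  "subnet w m = w * m"

definition subnet_gradient ::
    "(real ^ 'd \<Rightarrow> real ^ 'd ^ 'd) \<Rightarrow> real ^ 'd \<Rightarrow> real ^ 'd \<Rightarrow> real ^ 'd \<Rightarrow> real ^ 'd" where
  "subnet_gradient H w m sg = sg + H w *v (subnet w m - w)"

definition sigma_rv :: "'a measure \<Rightarrow> ('a \<Rightarrow> 'b::topological_space) \<Rightarrow> 'a measure" where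
  "sigma_rv M X = vimage_algebra (space M) X borel"

definition cprob :: "'a measure \<Rightarrow> 'a measure \<Rightarrow> 'a set \<Rightarrow> 'a \<Rightarrow> real" where
  "cprob M \<F> E = real_cond_exp M \<F> (indicator E)"

definition cond_indep_var ::
    "'a measure \<Rightarrow> 'a measure \<Rightarrow> 'b measure \<Rightarrow> ('a \<Rightarrow> 'b) \<Rightarrow> 'c measure \<Rightarrow> ('a \<Rightarrow> 'c) \<Rightarrow> bool" where
  "cond_indep_var M \<F> N X N' Y \<longleftrightarrow>
     X \<in> measurable M N \<and> Y \<in> measurable M N' \<and>
     (\<forall>A\<in>sets N. \<forall>B\<in>sets N'.
        AE x in M. cprob M \<F> ((X -` A \<inter> space M) \<inter> (Y -` B \<inter> space M)) x
                 = cprob M \<F> (X -` A \<inter> space M) x * cprob M \<F> (Y -` B \<inter> space M) x)"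

definition cond_indep_vars ::
    "'a measure \<Rightarrow> 'a measure \<Rightarrow> ('i \<Rightarrow> 'b measure) \<Rightarrow> ('i \<Rightarrow> 'a \<Rightarrow> 'b) \<Rightarrow> 'i set \<Rightarrow> bool" where
  "cond_indep_vars M \<F> N X I \<longleftrightarrow>
     (\<forall>i\<in>I. X i \<in> measurable M (N i)) \<and>
     (\<forall>J\<subseteq>I. J \<noteq> {} \<longrightarrow> finite J \<longrightarrow> (\<forall>A\<in>(\<Pi> j\<in>J. sets (N j)).
        AE x in M. cprob M \<F> (\<Inter>j\<in>J. X j -` A j \<inter> space M) x
                 = (\<Prod>j\<in>J. cprob M \<F> (X j -` A j \<inter> space M) x)))"

text \<open>Only the conditional law of each single entry of a mask is prescribed; no joint law of the
  entries is assumed.\<close>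

definition dropout_mask ::
    "'a measure \<Rightarrow> 'a measure \<Rightarrow> real \<Rightarrow> ('a \<Rightarrow> real ^ 'd) \<Rightarrow> bool" where
  "dropout_mask M \<F> \<gamma> m \<longleftrightarrow>
     m \<in> borel_measurable M \<and>
     (\<forall>i. (AE x in M. cprob M \<F> {y \<in> space M. m y $ i = 1 / (1 - \<gamma>)} x = 1 - \<gamma>) \<and>
          (AE x in M. cprob M \<F> {y \<in> space M. m y $ i = 0} x = \<gamma>))"

text \<open>Stochastic gradients \<open>sg k\<close> of devices \<open>k = 1, \<dots>, K\<close> at the \<open>\<F>\<close>-measurable random point \<open>w\<close>:
  conditionally on \<open>\<F>\<close> they are independent, unbiased (entry by entry) and of variance at most
  \<open>\<sigma>\<^sup>2 / D k\<close>. The variance is an extended nonnegative conditional expectation, so the bound includes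
  its finiteness; whenever \<open>g \<circ> w\<close> is integrable, so is each \<open>sg k\<close>, and the real conditional
  expectation is then a genuine one.\<close>

definition stochastic_gradients ::
    "'a measure \<Rightarrow> 'a measure \<Rightarrow> (real ^ 'd \<Rightarrow> real ^ 'd) \<Rightarrow> real \<Rightarrow> nat \<Rightarrow> (nat \<Rightarrow> nat) \<Rightarrow>
     ('a \<Rightarrow> real ^ 'd) \<Rightarrow> (nat \<Rightarrow> 'a \<Rightarrow> real ^ 'd) \<Rightarrow> bool" where
  "stochastic_gradients M \<F> g \<sigma> K D w sg \<longleftrightarrow>
     cond_indep_vars M \<F> (\<lambda>_. borel) sg {1..K} \<and>
     (\<forall>k\<in>{1..K}. \<forall>i.
        AE x in M. real_cond_exp M \<F> (\<lambda>y. sg k y $ i) x = g (w x) $ i) \<and>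
     (\<forall>k\<in>{1..K}.
        AE x in M. nn_cond_exp M \<F> (\<lambda>y. ennreal ((norm (sg k y - g (w y)))\<^sup>2)) x
                 \<le> ennreal (\<sigma>\<^sup>2 / real (D k)))"

text \<open>Round \<open>t\<close>: given \<open>w t\<close>, the draws are fresh, i.e. conditionally independent of all masks and
  stochastic gradients of the earlier rounds.\<close>

definition fresh_draws ::
    "'a measure \<Rightarrow> (real ^ 'd \<Rightarrow> real ^ 'd) \<Rightarrow> real \<Rightarrow> nat \<Rightarrow> (nat \<Rightarrow> nat) \<Rightarrow> (nat \<Rightarrow> nat \<Rightarrow> real) \<Rightarrow>
     (nat \<Rightarrow> 'a \<Rightarrow> real ^ 'd) \<Rightarrow> (nat \<Rightarrow> nat \<Rightarrow> 'a \<Rightarrow> real ^ 'd) \<Rightarrow>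
     (nat \<Rightarrow> nat \<Rightarrow> 'a \<Rightarrow> real ^ 'd) \<Rightarrow> nat \<Rightarrow> bool" where
  "fresh_draws M g \<sigma> K D \<gamma> w m sg t \<longleftrightarrow>
     (let \<F> = sigma_rv M (w t) in
        (\<forall>k\<in>{1..K}. dropout_mask M \<F> (\<gamma> k t) (m k t)) \<and>
        stochastic_gradients M \<F> g \<sigma> K D (w t) (\<lambda>k. sg k t) \<and>
        cond_indep_var M \<F>
          (Pi\<^sub>M {1..K} (\<lambda>_. borel)) (\<lambda>x. \<lambda>k\<in>{1..K}. m k t x)
          (Pi\<^sub>M {1..K} (\<lambda>_. borel)) (\<lambda>x. \<lambda>k\<in>{1..K}. sg k t x) \<and>
        cond_indep_var M \<F>
          (Pi\<^sub>M {1..K} (\<lambda>_. borel \<Otimes>\<^sub>M borel)) (\<lambda>x. \<lambda>k\<in>{1..K}. (m k t x, sg k t x))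
          (Pi\<^sub>M ({1..K} \<times> {..<t}) (\<lambda>_. borel \<Otimes>\<^sub>M borel))
          (\<lambda>x. \<lambda>(k, s)\<in>{1..K} \<times> {..<t}. (m k s x, sg k s x)))"

text \<open>\<open>T\<close> rounds of FedDrop on the probability space \<open>M\<close>, with learning rate \<open>\<eta>\<close> and dropout rates
  \<open>\<gamma> k t\<close>; \<open>D k\<close> is the size of the dataset of device \<open>k\<close>.\<close>

definition feddrop_run ::
    "'a measure \<Rightarrow> nat \<Rightarrow> real \<Rightarrow> (real ^ 'd \<Rightarrow> real ^ 'd) \<Rightarrow> (real ^ 'd \<Rightarrow> real ^ 'd ^ 'd) \<Rightarrow>
     real \<Rightarrow> nat \<Rightarrow> (nat \<Rightarrow> nat) \<Rightarrow> (nat \<Rightarrow> nat \<Rightarrow> real) \<Rightarrow> real ^ 'd \<Rightarrow>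
     (nat \<Rightarrow> 'a \<Rightarrow> real ^ 'd) \<Rightarrow> (nat \<Rightarrow> nat \<Rightarrow> 'a \<Rightarrow> real ^ 'd) \<Rightarrow>
     (nat \<Rightarrow> nat \<Rightarrow> 'a \<Rightarrow> real ^ 'd) \<Rightarrow> bool" where
  "feddrop_run M T \<eta> g H \<sigma> K D \<gamma> w0 w m sg \<longleftrightarrow>
     prob_space M \<and>
     (\<forall>x\<in>space M. w 0 x = w0) \<and>
     (\<forall>t<T. \<forall>x\<in>space M.
        w (Suc t) x = w t x - \<eta> *\<^sub>R (\<Sum>k=1..K. (real (D k) / real (\<Sum>j=1..K. D j)) *\<^sub>R
                                       subnet_gradient H (w t x) (m k t x) (sg k t x))) \<and>
     (\<forall>t<T. fresh_draws M g \<sigma> K D \<gamma> w m sg t)"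

end

theory Submission
  imports Defs
begin

text \<open>The Frobenius bound makes \<open>g\<close> Lipschitz with constant \<open>\<bar>A\<bar>\<close>, so the second moments of \<open>g (w t)\<close>
  are bounded independently of \<open>T\<close>. Mask entries are almost surely at most \<open>1 / (1 - \<theta>)\<close> and have
  conditional mean \<open>1\<close>, so the update direction \<open>U\<close> of each round has uniformly bounded second moment
  and satisfies \<open>E[U \<bullet> g (w t)] = E[\<parallel>g (w t)\<parallel>\<^sup>2]\<close>. Smoothness and telescoping then bound the average
  by a constant over \<open>sqrt T\<close>. The constant is not the one in \<open>G_T\<close>, but since \<open>G_T\<close> is itself a limit,
  equal to \<open>0\<close>, only the order matters.\<close>

section \<open>Norm inequalities, measurability and integrability\<close>

lemma norm_matrix_vector_le_frobenius:
  fixes B :: "real ^ 'n ^ 'm"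
  shows "norm (B *v h) \<le> frobenius_norm B * norm h"
proof (rule power2_le_imp_le)
  \<comment> \<open>Cauchy-Schwarz is applied to each row separately; summing over the rows then
    produces the Frobenius norm.\<close>
  have row: "((B *v h) $ i)\<^sup>2 \<le> (\<Sum>j\<in>UNIV. (B $ i $ j)\<^sup>2) * (norm h)\<^sup>2" for i
  proof -
    have "((B *v h) $ i)\<^sup>2 = (B $ i \<bullet> h)\<^sup>2"
      by (simp add: matrix_mult_dot)
    also have "\<dots> \<le> (B $ i \<bullet> B $ i) * (h \<bullet> h)"
      by (rule Cauchy_Schwarz_ineq)
    also have "\<dots> = (\<Sum>j\<in>UNIV. (B $ i $ j)\<^sup>2) * (norm h)\<^sup>2"
      by (simp add: dot_square_norm) (simp add: norm_vec_def L2_set_def sum_nonneg)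
    finally show ?thesis .
  qed
  have "(norm (B *v h))\<^sup>2 = (\<Sum>i\<in>UNIV. ((B *v h) $ i)\<^sup>2)"
    by (simp add: norm_vec_def L2_set_def sum_nonneg)
  also have "\<dots> \<le> (\<Sum>i\<in>UNIV. (\<Sum>j\<in>UNIV. (B $ i $ j)\<^sup>2) * (norm h)\<^sup>2)"
    by (intro sum_mono row)
  also have "\<dots> = (frobenius_norm B * norm h)\<^sup>2"
    by (simp add: frobenius_norm_def power_mult_distrib sum_nonneg sum_distrib_right)
  finally show "(norm (B *v h))\<^sup>2 \<le> (frobenius_norm B * norm h)\<^sup>2" .
qed (simp add: frobenius_norm_def sum_nonneg)

lemma borel_measurable_vec_component:
  fixes f :: "'a \<Rightarrow> real ^ 'n"
  assumes "f \<in> borel_measurable N"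
  shows "(\<lambda>x. f x $ i) \<in> borel_measurable N"
  using borel_measurable_continuous_onI[OF linear_continuous_on[OF bounded_linear_vec_nth]] assms
  by (rule measurable_compose_rev)

lemma borel_measurable_vecI:
  fixes f :: "'a \<Rightarrow> real ^ 'n"
  assumes "\<And>i. (\<lambda>x. f x $ i) \<in> borel_measurable N"
  shows "f \<in> borel_measurable N"
  by (subst borel_measurable_euclidean_space)
     (use assms in \<open>auto simp: Basis_vec_def inner_axis\<close>)

lemma integrable_dominated_nonneg:
  fixes f g :: "'a \<Rightarrow> real"
  assumes "integrable M g" "f \<in> borel_measurable M" "AE x in M. 0 \<le> f x \<and> f x \<le> g x"
  shows "integrable M f"
  using assms by (intro Bochner_Integration.integrable_bound[OF assms(1,2)]) auto

text \<open>The product is dominated by the sum of the two squares. This form serves the products of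
  gradient entries with noise entries and with iterate entries.\<close>

lemma integrable_mult_square_integrable:
  fixes f g :: "'a \<Rightarrow> real"
  assumes [measurable]: "f \<in> borel_measurable M" "g \<in> borel_measurable M"
    and "integrable M (\<lambda>x. (f x)\<^sup>2)" "integrable M (\<lambda>x. (g x)\<^sup>2)"
  shows "integrable M (\<lambda>x. f x * g x)"
proof (rule Bochner_Integration.integrable_bound)
  show "integrable M (\<lambda>x. (f x)\<^sup>2 + (g x)\<^sup>2)"
    using assms by auto
  have "\<bar>a * b\<bar> \<le> a\<^sup>2 + b\<^sup>2" for a b :: real
  proof -
    have "0 \<le> (\<bar>a\<bar> - \<bar>b\<bar>)\<^sup>2" "0 \<le> \<bar>a\<bar> * \<bar>b\<bar>" by auto
    then show ?thesis unfolding abs_mult power2_diff power2_abs by linarith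
  qed
  then show "AE x in M. norm (f x * g x) \<le> norm ((f x)\<^sup>2 + (g x)\<^sup>2)"
    by auto
qed measurable

lemma norm_add3_sq_le:
  fixes a b c :: "'a::real_inner"
  shows "(norm (a + b + c))\<^sup>2 \<le> 3 * ((norm a)\<^sup>2 + (norm b)\<^sup>2 + (norm c)\<^sup>2)"
proof -
  \<comment> \<open>The sum of the squared pairwise distances is exactly the difference of the two
    sides of the claim.\<close>
  have "0 \<le> (norm (a - b))\<^sup>2 + (norm (b - c))\<^sup>2 + (norm (a - c))\<^sup>2" by simp
  then show ?thesis
    by (simp add: power2_norm_eq_inner inner_add_left inner_add_right inner_diff_left
        inner_diff_right inner_commute)
qed

text \<open>Triangle inequality followed by Jensen for the square. It passes second-moment bounds of
  the single devices on to their weighted average.\<close>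

lemma norm_convex_sum_sq_le:
  fixes v :: "'i \<Rightarrow> 'a::real_inner"
  assumes "finite I" "\<And>k. k \<in> I \<Longrightarrow> 0 \<le> p k" "(\<Sum>k\<in>I. p k) = 1"
  shows "(norm (\<Sum>k\<in>I. p k *\<^sub>R v k))\<^sup>2 \<le> (\<Sum>k\<in>I. p k * (norm (v k))\<^sup>2)"
proof -
  have "norm (\<Sum>k\<in>I. p k *\<^sub>R v k) \<le> (\<Sum>k\<in>I. p k * norm (v k))"
    using assms(2) by (intro order.trans[OF norm_sum] sum_mono) auto
  then have "(norm (\<Sum>k\<in>I. p k *\<^sub>R v k))\<^sup>2 \<le> (\<Sum>k\<in>I. p k * norm (v k))\<^sup>2"
    by (simp add: power_mono)
  also have "\<dots> \<le> (\<Sum>k\<in>I. p k * (norm (v k))\<^sup>2)"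
    using convex_on_sum[OF assms(1) _ convex_power2 assms(3,2), of "\<lambda>k. norm (v k)"] assms
    by (cases "I = {}") auto
  finally show ?thesis .
qed

section \<open>Conditioning on the sigma-algebra generated by an iterate\<close>

lemma (in prob_space) sigma_rv_subalgebra:
  assumes "X \<in> borel_measurable M"
  shows "subalgebra M (sigma_rv M X)"
  unfolding subalgebra_def sigma_rv_def
  using assms by (auto simp: sets_vimage_algebra2 measurable_space intro: measurable_sets)

lemma borel_measurable_sigma_rv:
  assumes "f \<in> borel_measurable borel"
  shows "(\<lambda>x. f (X x)) \<in> borel_measurable (sigma_rv M X)"
proof -
  have "X \<in> measurable (sigma_rv M X) borel"
    unfolding sigma_rv_def by (rule measurable_vimage_algebra1) auto
  then show ?thesis using assms by (rule measurable_compose)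
qed

lemma (in prob_space) sigma_finite_subalgebra_prob:
  assumes "subalgebra M N"
  shows "sigma_finite_subalgebra M N"
proof -
  interpret finite_measure_subalgebra M N
    by unfold_locales (use assms in \<open>auto\<close>)
  show ?thesis by unfold_locales
qed

text \<open>An \<open>N\<close>-measurable factor \<open>f\<close> passes through the conditional
  expectation of the indicator, which is the constant \<open>c\<close>. All information on the mask
  law enters the proof through this identity.\<close>

lemma (in prob_space) integral_indicator_cprob_const:
  assumes "subalgebra M N" "E \<in> events" "AE x in M. cprob M N E x = c"
    and "f \<in> borel_measurable N" "integrable M f"
  shows "(\<integral>x. f x * indicator E x \<partial>M) = c * (\<integral>x. f x \<partial>M)"
proof -
  interpret sigma_finite_subalgebra M N
    by (rule sigma_finite_subalgebra_prob) fact
  have int: "integrable M (\<lambda>x. f x * indicator E x)"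
    using assms(2,5) by (rule integrable_real_mult_indicator)
  have "(\<integral>x. f x * indicator E x \<partial>M) = (\<integral>x. f x * real_cond_exp M N (indicator E) x \<partial>M)"
    using real_cond_exp_intg(2)[OF int assms(4)] assms(2) by auto
  also have "\<dots> = (\<integral>x. f x * c \<partial>M)"
    using assms(3,5) by (intro integral_cong_AE) (auto simp: cprob_def)
  finally show ?thesis by simp
qed

lemma (in prob_space) prob_eq_cprob_const:
  assumes "subalgebra M N" "E \<in> events" "AE x in M. cprob M N E x = c"
  shows "prob E = c"
proof -
  have "(\<integral>x. 1 * indicator E x \<partial>M) = c * (\<integral>x. 1 \<partial>M)"
    by (rule integral_indicator_cprob_const) (use assms in auto)
  then show ?thesis
    using sets.sets_into_space[OF assms(2)] by (simp add: prob_space Int_absorb2)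
qed

section \<open>Dropout masks and conditional variances\<close>

context prob_space
begin

context
  fixes N :: "'a measure" and \<gamma> :: real and m :: "'a \<Rightarrow> real ^ 'd"
  assumes N: "subalgebra M N" and mask: "dropout_mask M N \<gamma> m"
    and \<gamma>: "0 \<le> \<gamma>" "\<gamma> < 1"
begin

lemma mask_measurable: "m \<in> borel_measurable M"
  using mask by (simp add: dropout_mask_def)

lemma mask_events: "{y \<in> space M. m y $ i = c} \<in> events"
  using borel_measurable_vec_component[OF mask_measurable, of i] by simp

text \<open>Constant conditional probabilities are also the unconditional ones, and those of the two
  values add up to \<open>1\<close>.\<close>

lemma mask_two_valued:
  "AE x in M. m x $ i = 1 / (1 - \<gamma>) \<or> m x $ i = 0"
proof -
  let ?E = "\<lambda>c. {y \<in> space M. m y $ i = c}"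
  have p: "prob (?E (1 / (1 - \<gamma>))) = 1 - \<gamma>" "prob (?E 0) = \<gamma>"
    using prob_eq_cprob_const[OF N mask_events, of i "1 / (1 - \<gamma>)" "1 - \<gamma>"]
      prob_eq_cprob_const[OF N mask_events, of i 0 \<gamma>] mask
    unfolding dropout_mask_def by blast+
  \<comment> \<open>Additivity holds because \<open>1 / (1 - \<gamma>)\<close> is not
    \<open>0\<close>, so the two events are disjoint.\<close>
  have "prob (?E (1 / (1 - \<gamma>)) \<union> ?E 0) = prob (?E (1 / (1 - \<gamma>))) + prob (?E 0)"
    using \<gamma> by (intro finite_measure_Union mask_events) auto
  then have "prob (?E (1 / (1 - \<gamma>)) \<union> ?E 0) = 1"
    using p by simp
  then have "AE x in M. x \<in> ?E (1 / (1 - \<gamma>)) \<union> ?E 0"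
    using mask_events by (subst (asm) prob_eq_1) auto
  then show ?thesis
    by (rule AE_mp) auto
qed

lemma mask_deviation_le: "AE x in M. \<bar>m x $ i - 1\<bar> \<le> 1 / (1 - \<gamma>)"
  using mask_two_valued[of i]
proof (rule AE_mp)
  \<comment> \<open>The two cases: a kept entry deviates from \<open>1\<close> by
    \<open>1 / (1 - \<gamma>) - 1\<close>, a dropped one by \<open>1\<close>.\<close>
  have "\<bar>1 / (1 - \<gamma>) - 1\<bar> \<le> 1 / (1 - \<gamma>)" "1 \<le> 1 / (1 - \<gamma>)"
    using \<gamma> by (auto simp: abs_if)
  then show "AE x in M. m x $ i = 1 / (1 - \<gamma>) \<or> m x $ i = 0
      \<longrightarrow> \<bar>m x $ i - 1\<bar> \<le> 1 / (1 - \<gamma>)"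
    by (intro AE_I2) auto
qed

text \<open>Entry \<open>i\<close> of the deviation is \<open>v x $ i * (m x $ i - 1)\<close>, so
  the almost sure bound on the mask entries, taken over all of the finitely many indices at once,
  scales every component.\<close>

lemma subnet_deviation_le:
  "AE x in M. norm (subnet (v x) (m x) - v x) \<le> norm (v x) / (1 - \<gamma>)"
proof -
  have "AE x in M. \<forall>i. \<bar>m x $ i - 1\<bar> \<le> 1 / (1 - \<gamma>)"
    using mask_deviation_le by (simp add: AE_all_countable)
  then show ?thesis
  proof (rule AE_mp, intro AE_I2 impI)
    fix x assume le: "\<forall>i. \<bar>m x $ i - 1\<bar> \<le> 1 / (1 - \<gamma>)"
    have "norm (subnet (v x) (m x) - v x) \<le> norm ((1 / (1 - \<gamma>)) *\<^sub>R v x)"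
    proof (rule norm_le_componentwise_cart)
      fix i
      have "\<bar>v x $ i\<bar> * \<bar>m x $ i - 1\<bar> \<le> \<bar>v x $ i\<bar> * (1 / (1 - \<gamma>))"
        using le by (intro mult_left_mono) auto
      then show "norm ((subnet (v x) (m x) - v x) $ i) \<le> norm (((1 / (1 - \<gamma>)) *\<^sub>R v x) $ i)"
        using \<gamma> by (simp add: subnet_def abs_mult[symmetric] right_diff_distrib)
    qed
    then show "norm (subnet (v x) (m x) - v x) \<le> norm (v x) / (1 - \<gamma>)"
      using \<gamma> by simp
  qed
qed

text \<open>A kept entry has value \<open>1 / (1 - \<gamma>)\<close> and conditional probability
  \<open>1 - \<gamma>\<close>, so the conditional mean of an entry is \<open>1\<close>. The fact is
  put in weak form, tested against \<open>N\<close>-measurable integrable \<open>f\<close>, which is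
  how it is applied to the Hessian term.\<close>

lemma mask_deviation_orthogonal:
  assumes f: "f \<in> borel_measurable N" "integrable M f"
  shows "integrable M (\<lambda>x. f x * (m x $ i - 1))" "(\<integral>x. f x * (m x $ i - 1) \<partial>M) = 0"
proof -
  let ?E = "{y \<in> space M. m y $ i = 1 / (1 - \<gamma>)}"
  have [measurable]: "f \<in> borel_measurable M"
    using f(2) by (rule borel_measurable_integrable)
  have [measurable]: "(\<lambda>x. m x $ i) \<in> borel_measurable M"
    by (rule borel_measurable_vec_component[OF mask_measurable])
  have [measurable]: "?E \<in> events" by (rule mask_events)
  have int: "integrable M (\<lambda>x. f x * indicator ?E x)"
    using f by (intro integrable_real_mult_indicator) auto
  \<comment> \<open>Off a null set the mask entry is the indicator of \<open>?E\<close> divided by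
    \<open>1 - \<gamma>\<close>.\<close>
  have eq: "AE x in M. f x * (m x $ i - 1) = f x * indicator ?E x / (1 - \<gamma>) - f x"
    using mask_two_valued[of i] \<gamma>
    by (elim AE_mp) (auto intro!: AE_I2 simp: right_diff_distrib indicator_def)
  have "integrable M (\<lambda>x. f x * indicator ?E x / (1 - \<gamma>) - f x)"
    using int f by auto
  then show "integrable M (\<lambda>x. f x * (m x $ i - 1))"
    using eq by (subst integrable_cong_AE) auto
  have "(\<integral>x. f x * (m x $ i - 1) \<partial>M) = (\<integral>x. f x * indicator ?E x / (1 - \<gamma>) - f x \<partial>M)"
    using eq by (intro integral_cong_AE) auto
  also have "\<dots> = (\<integral>x. f x * indicator ?E x \<partial>M) / (1 - \<gamma>) - (\<integral>x. f x \<partial>M)"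
    using int f by simp
  also have "(\<integral>x. f x * indicator ?E x \<partial>M) = (1 - \<gamma>) * (\<integral>x. f x \<partial>M)"
    using mask f by (intro integral_indicator_cprob_const[OF N]) (auto simp: dropout_mask_def)
  finally show "(\<integral>x. f x * (m x $ i - 1) \<partial>M) = 0"
    using \<gamma> by simp
qed

end

text \<open>The defining identity of \<open>nn_cond_exp\<close>, tested with the constant
  \<open>1\<close>, gives the unconditional bound. Working with extended nonnegative integrals
  yields integrability and the bound together.\<close>

lemma square_integral_le_of_nn_cond_exp_le:
  fixes Z :: "'a \<Rightarrow> 'b::euclidean_space"
  assumes N: "subalgebra M N" and [measurable]: "Z \<in> borel_measurable M"
    and le: "AE x in M. nn_cond_exp M N (\<lambda>y. ennreal ((norm (Z y))\<^sup>2)) x \<le> ennreal c"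
    and c: "0 \<le> c"
  shows "integrable M (\<lambda>x. (norm (Z x))\<^sup>2)" "(\<integral>x. (norm (Z x))\<^sup>2 \<partial>M) \<le> c"
proof -
  interpret sigma_finite_subalgebra M N
    by (rule sigma_finite_subalgebra_prob) fact
  have "(\<integral>\<^sup>+x. ennreal ((norm (Z x))\<^sup>2) \<partial>M)
      = (\<integral>\<^sup>+x. nn_cond_exp M N (\<lambda>y. ennreal ((norm (Z y))\<^sup>2)) x \<partial>M)"
    using nn_cond_exp_intg[of "\<lambda>_. 1" "\<lambda>y. ennreal ((norm (Z y))\<^sup>2)"] by simp
  also have "\<dots> \<le> (\<integral>\<^sup>+x. ennreal c \<partial>M)"
    using le by (rule nn_integral_mono_AE)
  finally have nn: "(\<integral>\<^sup>+x. ennreal ((norm (Z x))\<^sup>2) \<partial>M) \<le> ennreal c"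
    by (simp add: emeasure_space_1)
  then show int: "integrable M (\<lambda>x. (norm (Z x))\<^sup>2)"
    by (intro integrableI_bounded) (auto simp: le_less_trans)
  show "(\<integral>x. (norm (Z x))\<^sup>2 \<partial>M) \<le> c"
    using nn c by (simp add: nn_integral_eq_integral[OF int])
qed

end

section \<open>Regularity and growth of the loss, its gradient and its Hessian\<close>

locale smooth_loss =
  fixes F :: "real ^ 'd \<Rightarrow> real" and g :: "real ^ 'd \<Rightarrow> real ^ 'd"
    and H :: "real ^ 'd \<Rightarrow> real ^ 'd ^ 'd" and A L Fstar :: real
  assumes gradient: "\<And>v. GDERIV F v :> g v"
    and hessian: "\<And>v. (g has_derivative (\<lambda>h. H v *v h)) (at v)"
    and hessian_bound: "\<And>v. (frobenius_norm (H v))\<^sup>2 \<le> A\<^sup>2"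
    and lower_bound: "\<And>v. Fstar \<le> F v"
    and L_pos: "L > 0"
    and smooth: "\<And>u v. F v \<le> F u + (v - u) \<bullet> g u + L / 2 * (norm (v - u))\<^sup>2"
begin

lemma norm_hessian_mult_le: "norm (H v *v h) \<le> \<bar>A\<bar> * norm h"
proof -
  have "\<bar>frobenius_norm (H v)\<bar> \<le> \<bar>A\<bar>"
    using hessian_bound[of v] by (simp only: abs_le_square_iff)
  then have "frobenius_norm (H v) * norm h \<le> \<bar>A\<bar> * norm h"
    by (intro mult_right_mono) auto
  with norm_matrix_vector_le_frobenius show ?thesis
    by (rule order.trans)
qed

text \<open>Mean value inequality: the operator norm of the Hessian is at most its Frobenius norm,
  hence at most \<open>\<bar>A\<bar>\<close>.\<close>

lemma norm_gradient_diff_le: "norm (g u - g v) \<le> \<bar>A\<bar> * norm (u - v)"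
proof (rule differentiable_bound)
  show "(g has_derivative (\<lambda>h. H x *v h)) (at x within UNIV)" for x
    using hessian by simp
  show "onorm (\<lambda>h. H x *v h) \<le> \<bar>A\<bar>" for x
    by (rule onorm_le) (rule norm_hessian_mult_le)
qed simp_all

text \<open>Comparison with the gradient at \<open>0\<close> through the Lipschitz bound, then
  \<open>(a + b)\<^sup>2 \<le> 2 * a\<^sup>2 + 2 * b\<^sup>2\<close>. It reduces second moments of
  the gradient to those of the iterate.\<close>

lemma norm_gradient_sq_le: "(norm (g v))\<^sup>2 \<le> 2 * (norm (g 0))\<^sup>2 + 2 * A\<^sup>2 * (norm v)\<^sup>2"
proof -
  have "norm (g v) \<le> norm (g 0) + norm (g v - g 0)"
    by (rule norm_triangle_sub)
  also have "\<dots> \<le> norm (g 0) + \<bar>A\<bar> * norm v"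
    using norm_gradient_diff_le[of v 0] by simp
  finally have "(norm (g v))\<^sup>2 \<le> (norm (g 0) + \<bar>A\<bar> * norm v)\<^sup>2"
    by (simp add: power_mono)
  also have "\<dots> \<le> 2 * (norm (g 0))\<^sup>2 + 2 * (\<bar>A\<bar> * norm v)\<^sup>2"
    using sum_squares_bound[of "norm (g 0)" "\<bar>A\<bar> * norm v"] by (simp add: power2_sum)
  finally show ?thesis by (simp add: power_mult_distrib)
qed

lemma gradient_measurable [measurable]: "g \<in> borel_measurable borel"
  by (intro borel_measurable_continuous_onI continuous_at_imp_continuous_on ballI
      has_derivative_continuous[OF hessian])

lemma loss_measurable [measurable]: "F \<in> borel_measurable borel"
  by (intro borel_measurable_continuous_onI continuous_at_imp_continuous_on ballI
      has_derivative_continuous[OF gradient[unfolded gderiv_def]])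

text \<open>\<open>H\<close> is given only as a derivative, with no continuity to rely on; its
  directional values are pointwise limits of difference quotients of the continuous map
  \<open>g\<close>, hence Borel.\<close>

lemma hessian_mult_measurable: "(\<lambda>v. H v *v h) \<in> borel_measurable borel"
proof (rule borel_measurable_LIMSEQ_metric)
  let ?\<delta> = "\<lambda>n. inverse (real (Suc n))"
  show "(\<lambda>v. (1 / ?\<delta> n) *\<^sub>R (g (v + ?\<delta> n *\<^sub>R h) - g v)) \<in> borel_measurable borel" for n
    by measurable
  show "(\<lambda>n. (1 / ?\<delta> n) *\<^sub>R (g (v + ?\<delta> n *\<^sub>R h) - g v)) \<longlonglongrightarrow> H v *v h" for v
  proof -
    \<comment> \<open>The chain rule along the line through \<open>v\<close> in direction
      \<open>h\<close> reduces the limit to a derivative in one real variable.\<close>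
    have "((\<lambda>t. g (v + t *\<^sub>R h)) has_derivative (\<lambda>t. H v *v (t *\<^sub>R h))) (at 0)"
      by (rule has_derivative_compose[where f = "\<lambda>t. v + t *\<^sub>R h" and g = g])
         (auto intro!: derivative_eq_intros hessian simp: hessian)
    then have "((\<lambda>t. norm (g (v + t *\<^sub>R h) - g v - t *\<^sub>R (H v *v h)) / \<bar>t\<bar>) \<longlongrightarrow> 0) (at 0)"
      by (simp add: has_derivative_at matrix_vector_mult_scaleR)
    then have "((\<lambda>t. norm ((1 / t) *\<^sub>R (g (v + t *\<^sub>R h) - g v) - H v *v h)) \<longlongrightarrow> 0) (at 0)"
    proof (rule Lim_transform_eventually)
      have "norm (g (v + t *\<^sub>R h) - g v - t *\<^sub>R (H v *v h)) / \<bar>t\<bar>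
          = norm ((1 / t) *\<^sub>R (g (v + t *\<^sub>R h) - g v) - H v *v h)" if "t \<noteq> 0" for t
      proof -
        have "(1 / t) *\<^sub>R (g (v + t *\<^sub>R h) - g v) - H v *v h
            = (1 / t) *\<^sub>R (g (v + t *\<^sub>R h) - g v - t *\<^sub>R (H v *v h))"
          using that by (simp add: scaleR_diff_right)
        then show ?thesis by simp
      qed
      then show "\<forall>\<^sub>F t in at 0. norm (g (v + t *\<^sub>R h) - g v - t *\<^sub>R (H v *v h)) / \<bar>t\<bar>
          = norm ((1 / t) *\<^sub>R (g (v + t *\<^sub>R h) - g v) - H v *v h)"
        by (auto simp: eventually_at_filter)
    qed
    then have "((\<lambda>t. (1 / t) *\<^sub>R (g (v + t *\<^sub>R h) - g v)) \<longlongrightarrow> H v *v h) (at 0)"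
      unfolding Lim_null[of _ "H v *v h"] by (rule tendsto_norm_zero_cancel)
    then show ?thesis
      by (rule filterlim_compose)
         (simp add: filterlim_at LIMSEQ_inverse_real_of_nat del: of_nat_Suc)
  qed
qed

lemma hessian_entry_measurable [measurable]: "(\<lambda>v. H v $ i $ j) \<in> borel_measurable borel"
  using borel_measurable_vec_component[OF hessian_mult_measurable[of "axis j 1"], of i]
  by (simp add: matrix_vector_mult_basis column_def)

lemma hessian_apply_measurable:
  assumes w: "w \<in> borel_measurable N" and u: "u \<in> borel_measurable N"
  shows "(\<lambda>x. H (w x) *v u x) \<in> borel_measurable N"
proof (rule borel_measurable_vecI)
  fix i
  have [measurable]: "(\<lambda>x. H (w x) $ i $ j) \<in> borel_measurable N" for j
    using measurable_compose[OF w hessian_entry_measurable] .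
  have [measurable]: "(\<lambda>x. u x $ j) \<in> borel_measurable N" for j
    using u by (rule borel_measurable_vec_component)
  show "(\<lambda>x. (H (w x) *v u x) $ i) \<in> borel_measurable N"
    unfolding matrix_vector_mult_def by simp
qed

section \<open>Integrability along an iterate and moments of one device's gradient\<close>

lemma integrable_gradient_sq:
  assumes "w \<in> borel_measurable M" "integrable M (\<lambda>x. (norm (w x))\<^sup>2)" "finite_measure M"
  shows "integrable M (\<lambda>x. (norm (g (w x)))\<^sup>2)"
proof (rule integrable_dominated_nonneg)
  interpret finite_measure M by fact
  show "integrable M (\<lambda>x. 2 * (norm (g 0))\<^sup>2 + 2 * A\<^sup>2 * (norm (w x))\<^sup>2)"
    using assms by auto
qed (use assms norm_gradient_sq_le in auto)

text \<open>Subtracting \<open>Fstar\<close> makes the loss nonnegative, and smoothness at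
  \<open>0\<close> bounds it above by a quadratic in the norm of the iterate.\<close>

lemma integrable_loss:
  assumes "w \<in> borel_measurable M" "integrable M (\<lambda>x. (norm (w x))\<^sup>2)" "finite_measure M"
  shows "integrable M (\<lambda>x. F (w x))"
proof -
  interpret finite_measure M by fact
  have ub: "F v - Fstar \<le> (F 0 - Fstar) + (norm (g 0))\<^sup>2 + (1 + L / 2) * (norm v)\<^sup>2" for v
  proof -
    have "F v \<le> F 0 + v \<bullet> g 0 + L / 2 * (norm v)\<^sup>2"
      using smooth[of v 0] by simp
    moreover have "v \<bullet> g 0 \<le> (norm (g 0))\<^sup>2 + (norm v)\<^sup>2"
    proof -
      have "0 \<le> (norm (v - g 0))\<^sup>2 + (norm v)\<^sup>2 + (norm (g 0))\<^sup>2" by simp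
      then show ?thesis
        by (simp add: power2_norm_eq_inner inner_diff_left inner_diff_right inner_commute)
    qed
    ultimately show ?thesis by (simp add: algebra_simps)
  qed
  have "integrable M (\<lambda>x. F (w x) - Fstar)"
  proof (rule integrable_dominated_nonneg)
    show "integrable M (\<lambda>x. (F 0 - Fstar) + (norm (g 0))\<^sup>2 + (1 + L / 2) * (norm (w x))\<^sup>2)"
      using assms by auto
  qed (use assms ub lower_bound in auto)
  then have "integrable M (\<lambda>x. (F (w x) - Fstar) + Fstar)"
    by (intro Bochner_Integration.integrable_add) auto
  then show ?thesis by simp
qed

text \<open>The subnet gradient splits into sampling noise, the true gradient and the Hessian term
  of the dropout. Each part has a controlled second moment. Paired with \<open>g (w x)\<close>, the
  noise and the dropout term integrate to \<open>0\<close>: the former by unbiasedness, the latter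
  because mask entries have conditional mean \<open>1\<close>.\<close>

lemma device_moments:
  fixes M :: "'a measure"
  assumes "prob_space M" and w: "w \<in> borel_measurable M" and sg: "sg \<in> borel_measurable M"
    and w_sq: "integrable M (\<lambda>x. (norm (w x))\<^sup>2)"
    and mask: "dropout_mask M (sigma_rv M w) \<gamma> m" and \<gamma>: "0 \<le> \<gamma>" "\<gamma> \<le> \<theta>" "\<theta> < 1"
    and unbiased: "\<And>i. AE x in M. real_cond_exp M (sigma_rv M w) (\<lambda>y. sg y $ i) x = g (w x) $ i"
    and variance: "AE x in M. nn_cond_exp M (sigma_rv M w)
           (\<lambda>y. ennreal ((norm (sg y - g (w y)))\<^sup>2)) x \<le> ennreal s"
    and s: "0 \<le> s"
  defines "U \<equiv> \<lambda>x. subnet_gradient H (w x) (m x) (sg x)"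
  shows "U \<in> borel_measurable M"
    and "integrable M (\<lambda>x. (norm (U x))\<^sup>2)"
    and "(\<integral>x. (norm (U x))\<^sup>2 \<partial>M)
      \<le> 3 * (s + (\<integral>x. (norm (g (w x)))\<^sup>2 \<partial>M) + (A / (1 - \<theta>))\<^sup>2 * (\<integral>x. (norm (w x))\<^sup>2 \<partial>M))"
    and "integrable M (\<lambda>x. U x \<bullet> g (w x))"
    and "(\<integral>x. U x \<bullet> g (w x) \<partial>M) = (\<integral>x. (norm (g (w x)))\<^sup>2 \<partial>M)"
proof -
  interpret prob_space M by fact
  let ?N = "sigma_rv M w"
  let ?r = "\<lambda>x. H (w x) *v (subnet (w x) (m x) - w x)"
  note [measurable] = w sg
  have N: "subalgebra M ?N" using w by (rule sigma_rv_subalgebra)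
  interpret sigma_finite_subalgebra M ?N using N by (rule sigma_finite_subalgebra_prob)
  have \<gamma>1: "\<gamma> < 1" using \<gamma> by simp
  note m = N mask \<gamma>(1) \<gamma>1
  have m_comp [measurable]: "(\<lambda>x. m x $ i) \<in> borel_measurable M" for i
    by (rule borel_measurable_vec_component[OF mask_measurable[OF m]])
  have w_comp [measurable]: "(\<lambda>x. w x $ i) \<in> borel_measurable M" for i
    by (rule borel_measurable_vec_component[OF w])
  have g_comp [measurable]: "(\<lambda>x. g (w x) $ i) \<in> borel_measurable M" for i
    by (rule borel_measurable_vec_component) measurable
  have sg_comp [measurable]: "(\<lambda>x. sg x $ i) \<in> borel_measurable M" for i
    by (rule borel_measurable_vec_component[OF sg])
  have dev [measurable]: "(\<lambda>x. subnet (w x) (m x) - w x) \<in> borel_measurable M"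
    by (rule borel_measurable_vecI) (simp add: subnet_def)
  have r [measurable]: "?r \<in> borel_measurable M"
    using w dev by (rule hessian_apply_measurable)
  have U: "U x = (sg x - g (w x)) + g (w x) + ?r x" for x
    by (simp add: U_def subnet_gradient_def)
  have U' [measurable]: "U \<in> borel_measurable M"
    unfolding U by measurable
  then show "U \<in> borel_measurable M" .
  have g_sq: "integrable M (\<lambda>x. (norm (g (w x)))\<^sup>2)"
    using w w_sq finite_measure_axioms by (rule integrable_gradient_sq)
  have "(\<lambda>x. sg x - g (w x)) \<in> borel_measurable M" by measurable
  note Z = square_integral_le_of_nn_cond_exp_le[OF N this variance s]

  have r_bound: "AE x in M. (norm (?r x))\<^sup>2 \<le> (A / (1 - \<theta>))\<^sup>2 * (norm (w x))\<^sup>2"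
    using subnet_deviation_le[OF m, of w]
  proof (rule AE_mp, intro AE_I2 impI)
    fix x assume le: "norm (subnet (w x) (m x) - w x) \<le> norm (w x) / (1 - \<gamma>)"
    have "norm (?r x) \<le> \<bar>A\<bar> * norm (subnet (w x) (m x) - w x)"
      by (rule norm_hessian_mult_le)
    \<comment> \<open>Passing from \<open>\<gamma>\<close> to \<open>\<theta>\<close> makes the
      constant the same for all devices, rounds and horizons.\<close>
    also have "\<dots> \<le> \<bar>A\<bar> * (norm (w x) / (1 - \<theta>))"
      using le \<gamma> by (intro mult_left_mono order.trans[OF le] divide_left_mono) auto
    finally have "(norm (?r x))\<^sup>2 \<le> (\<bar>A\<bar> * (norm (w x) / (1 - \<theta>)))\<^sup>2"
      by (simp add: power_mono)
    then show "(norm (?r x))\<^sup>2 \<le> (A / (1 - \<theta>))\<^sup>2 * (norm (w x))\<^sup>2"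
      by (simp add: power_mult_distrib power_divide)
  qed
  define B where "B x = 3 * ((norm (sg x - g (w x)))\<^sup>2 + (norm (g (w x)))\<^sup>2
      + (A / (1 - \<theta>))\<^sup>2 * (norm (w x))\<^sup>2)" for x
  have B: "integrable M B"
    unfolding B_def using Z(1) g_sq w_sq by auto
  have U_B: "AE x in M. (norm (U x))\<^sup>2 \<le> B x"
    using r_bound
  proof (rule AE_mp, intro AE_I2 impI)
    fix x assume "(norm (?r x))\<^sup>2 \<le> (A / (1 - \<theta>))\<^sup>2 * (norm (w x))\<^sup>2"
    then show "(norm (U x))\<^sup>2 \<le> B x"
      using norm_add3_sq_le[of "sg x - g (w x)" "g (w x)" "?r x"] unfolding U B_def by argo
  qed
  show U_sq: "integrable M (\<lambda>x. (norm (U x))\<^sup>2)"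
    using U_B by (intro integrable_dominated_nonneg[OF B]) auto
  have "(\<integral>x. (norm (U x))\<^sup>2 \<partial>M) \<le> (\<integral>x. B x \<partial>M)"
    using U_sq B U_B by (rule integral_mono_AE)
  also have "\<dots> = 3 * ((\<integral>x. (norm (sg x - g (w x)))\<^sup>2 \<partial>M) + (\<integral>x. (norm (g (w x)))\<^sup>2 \<partial>M)
      + (A / (1 - \<theta>))\<^sup>2 * (\<integral>x. (norm (w x))\<^sup>2 \<partial>M))"
    unfolding B_def using Z(1) g_sq w_sq by simp
  finally show "(\<integral>x. (norm (U x))\<^sup>2 \<partial>M)
      \<le> 3 * (s + (\<integral>x. (norm (g (w x)))\<^sup>2 \<partial>M) + (A / (1 - \<theta>))\<^sup>2 * (\<integral>x. (norm (w x))\<^sup>2 \<partial>M))"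
    using Z(2) by argo

  have comp_sq: "integrable M (\<lambda>x. (f x $ i)\<^sup>2)"
    if "f \<in> borel_measurable M" "integrable M (\<lambda>x. (norm (f x))\<^sup>2)" for f :: "'a \<Rightarrow> real ^ 'd" and i
  proof (rule integrable_dominated_nonneg[OF that(2)])
    show "AE x in M. 0 \<le> (f x $ i)\<^sup>2 \<and> (f x $ i)\<^sup>2 \<le> (norm (f x))\<^sup>2"
      by (auto intro!: AE_I2 simp: abs_le_square_iff[symmetric] component_le_norm_cart)
  qed (use borel_measurable_vec_component[OF that(1)] in measurable)
  have g_sq_comp: "integrable M (\<lambda>x. (g (w x) $ i)\<^sup>2)" for i
    by (rule comp_sq[OF _ g_sq]) measurable
  have sg_int: "integrable M (\<lambda>x. g (w x) $ i * sg x $ i)"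
    and sg_eq: "(\<integral>x. g (w x) $ i * sg x $ i \<partial>M) = (\<integral>x. (g (w x) $ i)\<^sup>2 \<partial>M)" for i
  proof -
    \<comment> \<open>Square integrability is available for the centred gradient. The product with
      \<open>sg\<close> is recovered by adding the square of the true gradient entry; its
      integrability is required before \<open>g (w x) $ i\<close> can be moved through the
      conditional expectation.\<close>
    have "integrable M (\<lambda>x. ((sg x - g (w x)) $ i)\<^sup>2)"
      by (rule comp_sq[OF _ Z(1)]) measurable
    then have "integrable M (\<lambda>x. g (w x) $ i * (sg x $ i - g (w x) $ i))"
      using g_sq_comp by (intro integrable_mult_square_integrable) auto
    then have "integrable M (\<lambda>x. g (w x) $ i * (sg x $ i - g (w x) $ i) + (g (w x) $ i)\<^sup>2)"
      using g_sq_comp by (rule Bochner_Integration.integrable_add)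
    then show int: "integrable M (\<lambda>x. g (w x) $ i * sg x $ i)"
      by (simp add: algebra_simps power2_eq_square)
    have "(\<lambda>x. g (w x) $ i) \<in> borel_measurable ?N"
      by (rule borel_measurable_sigma_rv) (rule borel_measurable_vec_component, measurable)
    then have "(\<integral>x. g (w x) $ i * sg x $ i \<partial>M)
        = (\<integral>x. g (w x) $ i * real_cond_exp M ?N (\<lambda>y. sg y $ i) x \<partial>M)"
      using real_cond_exp_intg(2)[OF int] by simp
    also have "\<dots> = (\<integral>x. (g (w x) $ i)\<^sup>2 \<partial>M)"
      using unbiased[of i] by (intro integral_cong_AE) (auto simp: power2_eq_square)
    finally show "(\<integral>x. g (w x) $ i * sg x $ i \<partial>M) = (\<integral>x. (g (w x) $ i)\<^sup>2 \<partial>M)" .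
  qed
  \<comment> \<open>These are the coefficients of the mask deviations \<open>m x $ j - 1\<close> in
    the inner product with the gradient. Being Borel functions of the iterate, they are admissible
    test functions.\<close>
  define c where "c i j v = g v $ i * H v $ i $ j * v $ j" for i j v
  have c_mask: "integrable M (\<lambda>x. c i j (w x) * (m x $ j - 1))"
    "(\<integral>x. c i j (w x) * (m x $ j - 1) \<partial>M) = 0" for i j
  proof -
    have [measurable]: "(\<lambda>v :: real ^ 'd. v $ j) \<in> borel_measurable borel"
      by (rule borel_measurable_vec_component) measurable
    have [measurable]: "(\<lambda>v. g v $ i) \<in> borel_measurable borel"
      by (rule borel_measurable_vec_component) measurable
    have c_meas [measurable]: "c i j \<in> borel_measurable borel"
      unfolding c_def by measurable
    have "integrable M (\<lambda>x. c i j (w x))"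
    proof (rule Bochner_Integration.integrable_bound)
      show "integrable M (\<lambda>x. \<bar>A\<bar> * \<bar>g (w x) $ i * w x $ j\<bar>)"
        using g_sq_comp comp_sq[OF w w_sq]
        by (intro integrable_mult_right integrable_abs integrable_mult_square_integrable) auto
      \<comment> \<open>Entry \<open>(i, j)\<close> is a component of \<open>H v\<close> applied to
        the unit vector \<open>axis j 1\<close>.\<close>
      have H_le: "\<bar>H v $ i $ j\<bar> \<le> \<bar>A\<bar>" for v
        using order.trans[OF component_le_norm_cart norm_hessian_mult_le[of v "axis j 1"], of i]
        by (simp add: matrix_vector_mult_basis column_def)
      have "\<bar>c i j v\<bar> \<le> \<bar>A\<bar> * \<bar>g v $ i * v $ j\<bar>" for v
        using mult_right_mono[OF H_le[of v], of "\<bar>g v $ i * v $ j\<bar>"]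
        by (simp add: c_def abs_mult mult_ac)
      then show "AE x in M. norm (c i j (w x)) \<le> norm (\<bar>A\<bar> * \<bar>g (w x) $ i * w x $ j\<bar>)"
        by (auto simp: abs_mult)
    qed measurable
    then show "integrable M (\<lambda>x. c i j (w x) * (m x $ j - 1))"
      "(\<integral>x. c i j (w x) * (m x $ j - 1) \<partial>M) = 0"
      using mask_deviation_orthogonal[OF m borel_measurable_sigma_rv[OF c_meas]] by auto
  qed
  \<comment> \<open>Each dropout term of this expansion contains a single mask entry, so the
    conditional laws of single entries determine its integral.\<close>
  have inner: "U x \<bullet> g (w x)
      = (\<Sum>i\<in>UNIV. g (w x) $ i * sg x $ i + (\<Sum>j\<in>UNIV. c i j (w x) * (m x $ j - 1)))" for x
    unfolding U_def subnet_gradient_def inner_vec_def c_def subnet_def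
    by (simp add: matrix_vector_mult_def algebra_simps sum_distrib_left sum_subtractf)
  show "integrable M (\<lambda>x. U x \<bullet> g (w x))"
    unfolding inner using sg_int c_mask(1)
    by (intro Bochner_Integration.integrable_sum Bochner_Integration.integrable_add)
  have "(\<integral>x. U x \<bullet> g (w x) \<partial>M) = (\<Sum>i\<in>UNIV. \<integral>x. (g (w x) $ i)\<^sup>2 \<partial>M)"
    unfolding inner using sg_int c_mask sg_eq
    by simp
  also have "\<dots> = (\<integral>x. (norm (g (w x)))\<^sup>2 \<partial>M)"
    using g_sq_comp by (simp add: norm_vec_def L2_set_def sum_nonneg)
  finally show "(\<integral>x. U x \<bullet> g (w x) \<partial>M) = (\<integral>x. (norm (g (w x)))\<^sup>2 \<partial>M)" .
qed

section \<open>Expected descent in one round\<close>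

definition gradient_bound :: "real \<Rightarrow> real" where
  "gradient_bound G = 2 * (norm (g 0))\<^sup>2 + 2 * A\<^sup>2 * G\<^sup>2"

text \<open>The second-moment bound of \<open>device_moments\<close> with
  \<open>\<sigma>\<^sup>2 / real (D k)\<close> enlarged to \<open>\<sigma>\<^sup>2\<close> and the
  two expectations replaced by their bounds, so that it depends neither on the device nor on the
  round.\<close>

definition update_bound :: "real \<Rightarrow> real \<Rightarrow> real \<Rightarrow> real" where
  "update_bound \<sigma> \<theta> G = 3 * (\<sigma>\<^sup>2 + gradient_bound G + (A / (1 - \<theta>))\<^sup>2 * G\<^sup>2)"

lemma expected_gradient_sq_le:
  assumes "prob_space M" "w \<in> borel_measurable M" "integrable M (\<lambda>x. (norm (w x))\<^sup>2)"
    and "(\<integral>x. (norm (w x))\<^sup>2 \<partial>M) \<le> G\<^sup>2"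
  shows "(\<integral>x. (norm (g (w x)))\<^sup>2 \<partial>M) \<le> gradient_bound G"
proof -
  interpret prob_space M by fact
  have "(\<integral>x. (norm (g (w x)))\<^sup>2 \<partial>M)
      \<le> (\<integral>x. 2 * (norm (g 0))\<^sup>2 + 2 * A\<^sup>2 * (norm (w x))\<^sup>2 \<partial>M)"
    using assms norm_gradient_sq_le finite_measure_axioms
    by (intro integral_mono integrable_gradient_sq) auto
  also have "\<dots> = 2 * (norm (g 0))\<^sup>2 + 2 * A\<^sup>2 * (\<integral>x. (norm (w x))\<^sup>2 \<partial>M)"
    using assms(3) by (simp add: prob_space)
  also have "\<dots> \<le> gradient_bound G"
    unfolding gradient_bound_def using assms(4) by (intro add_left_mono mult_left_mono) auto
  finally show ?thesis .
qed

text \<open>The smoothness inequality at the current iterate, integrated. The linear term yields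
  minus \<open>\<eta>\<close> times the expected squared gradient norm since every device
  contributes that same value; Jensen over the devices controls the quadratic term.\<close>

lemma round_descent:
  fixes M :: "'a measure" and m sg :: "nat \<Rightarrow> 'a \<Rightarrow> real ^ 'd"
  assumes "prob_space M" and K: "K \<ge> 1" and D: "\<And>k. k \<in> {1..K} \<Longrightarrow> D k \<ge> 1"
    and w: "w \<in> borel_measurable M" "integrable M (\<lambda>x. (norm (w x))\<^sup>2)"
      "(\<integral>x. (norm (w x))\<^sup>2 \<partial>M) \<le> G\<^sup>2"
    and w'_sq: "integrable M (\<lambda>x. (norm (w' x))\<^sup>2)"
    and \<gamma>: "\<And>k. k \<in> {1..K} \<Longrightarrow> \<gamma> k \<in> {0..<\<theta>}" and \<theta>: "\<theta> < 1"
    and mask: "\<And>k. k \<in> {1..K} \<Longrightarrow> dropout_mask M (sigma_rv M w) (\<gamma> k) (m k)"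
    and sg: "stochastic_gradients M (sigma_rv M w) g \<sigma> K D w sg"
    and step: "\<And>x. x \<in> space M \<Longrightarrow> w' x = w x - \<eta> *\<^sub>R
      (\<Sum>k=1..K. (real (D k) / real (\<Sum>j=1..K. D j)) *\<^sub>R subnet_gradient H (w x) (m k x) (sg k x))"
  shows "w' \<in> borel_measurable M"
    and "(\<integral>x. F (w' x) \<partial>M) \<le> (\<integral>x. F (w x) \<partial>M) - \<eta> * (\<integral>x. (norm (g (w x)))\<^sup>2 \<partial>M)
      + L / 2 * \<eta>\<^sup>2 * update_bound \<sigma> \<theta> G"
proof -
  interpret prob_space M by fact
  define p where "p k = real (D k) / real (\<Sum>j=1..K. D j)" for k
  define V where "V k x = subnet_gradient H (w x) (m k x) (sg k x)" for k x
  define U where "U x = (\<Sum>k=1..K. p k *\<^sub>R V k x)" for x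
  \<comment> \<open>The total size must be nonzero for the weights to sum to \<open>1\<close>;
    device \<open>1\<close> exists because \<open>K \<ge> 1\<close>.\<close>
  have "D 1 \<le> (\<Sum>j=1..K. D j)"
    using K by (intro member_le_sum) auto
  then have "(\<Sum>j=1..K. D j) \<noteq> 0"
    using D[of 1] K by (intro notI) simp
  then have p1: "(\<Sum>k=1..K. p k) = 1"
    unfolding p_def sum_divide_distrib[symmetric] of_nat_sum[symmetric]
    by (intro divide_self) (simp only: of_nat_eq_0_iff not_False_eq_True)
  have p0: "0 \<le> p k" for k by (simp add: p_def del: of_nat_sum)

  have device: "V k \<in> borel_measurable M \<and> integrable M (\<lambda>x. (norm (V k x))\<^sup>2)
      \<and> (\<integral>x. (norm (V k x))\<^sup>2 \<partial>M) \<le> update_bound \<sigma> \<theta> G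
      \<and> integrable M (\<lambda>x. V k x \<bullet> g (w x))
      \<and> (\<integral>x. V k x \<bullet> g (w x) \<partial>M) = (\<integral>x. (norm (g (w x)))\<^sup>2 \<partial>M)"
    if k: "k \<in> {1..K}" for k
  proof -
    have sgk: "sg k \<in> borel_measurable M"
      "AE x in M. real_cond_exp M (sigma_rv M w) (\<lambda>y. sg k y $ i) x = g (w x) $ i"
      "AE x in M. nn_cond_exp M (sigma_rv M w)
           (\<lambda>y. ennreal ((norm (sg k y - g (w y)))\<^sup>2)) x \<le> ennreal (\<sigma>\<^sup>2 / real (D k))" for i
      using sg k unfolding stochastic_gradients_def cond_indep_vars_def by auto
    have \<gamma>k: "0 \<le> \<gamma> k" "\<gamma> k \<le> \<theta>" using \<gamma>[OF k] by auto
    have s: "0 \<le> \<sigma>\<^sup>2 / real (D k)" by simp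
    note dm = device_moments[OF \<open>prob_space M\<close> w(1) sgk(1) w(2) mask[OF k] \<gamma>k \<theta> sgk(2,3) s,
      folded V_def]
    have "\<sigma>\<^sup>2 / real (D k) \<le> \<sigma>\<^sup>2 / 1"
      using D[OF k] by (intro divide_left_mono) auto
    moreover have "(\<integral>x. (norm (g (w x)))\<^sup>2 \<partial>M) \<le> gradient_bound G"
      using \<open>prob_space M\<close> w by (rule expected_gradient_sq_le)
    moreover have "(A / (1 - \<theta>))\<^sup>2 * (\<integral>x. (norm (w x))\<^sup>2 \<partial>M) \<le> (A / (1 - \<theta>))\<^sup>2 * G\<^sup>2"
      using w(3) by (intro mult_left_mono) auto
    ultimately have "(\<integral>x. (norm (V k x))\<^sup>2 \<partial>M) \<le> update_bound \<sigma> \<theta> G"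
      unfolding update_bound_def using dm(3) by argo
    then show ?thesis using dm by auto
  qed
  note [measurable] = w(1)
  have V_meas: "V k \<in> borel_measurable M" if "k \<in> {1..K}" for k
    using device[OF that] by blast
  have U_meas [measurable]: "U \<in> borel_measurable M"
    unfolding U_def using V_meas by (intro borel_measurable_sum borel_measurable_scaleR) auto
  have step': "w' x = w x - \<eta> *\<^sub>R U x" if "x \<in> space M" for x
    using step[OF that] by (simp add: U_def V_def p_def)
  show w': "w' \<in> borel_measurable M"
    by (subst measurable_cong[OF step']) measurable
  have "integrable M (\<lambda>x. \<Sum>k=1..K. p k * (V k x \<bullet> g (w x)))"
    using device by (intro Bochner_Integration.integrable_sum integrable_mult_right) blast
  then have Ug: "integrable M (\<lambda>x. U x \<bullet> g (w x))"
    by (simp add: U_def inner_sum_left)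
  have "(\<integral>x. U x \<bullet> g (w x) \<partial>M) = (\<Sum>k=1..K. p k * (\<integral>x. V k x \<bullet> g (w x) \<partial>M))"
    using device by (simp add: U_def inner_sum_left)
  also have "\<dots> = (\<Sum>k=1..K. p k * (\<integral>x. (norm (g (w x)))\<^sup>2 \<partial>M))"
    using device by (intro sum.cong) auto
  finally have Ug_eq: "(\<integral>x. U x \<bullet> g (w x) \<partial>M) = (\<integral>x. (norm (g (w x)))\<^sup>2 \<partial>M)"
    using p1 by (simp add: sum_distrib_right[symmetric])
  have V_sq: "integrable M (\<lambda>x. \<Sum>k=1..K. p k * (norm (V k x))\<^sup>2)"
    using device by (intro Bochner_Integration.integrable_sum integrable_mult_right) blast
  have U_le: "(norm (U x))\<^sup>2 \<le> (\<Sum>k=1..K. p k * (norm (V k x))\<^sup>2)" for x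
    unfolding U_def using p0 p1 by (intro norm_convex_sum_sq_le) auto
  have U_sq: "integrable M (\<lambda>x. (norm (U x))\<^sup>2)"
    using U_le by (intro integrable_dominated_nonneg[OF V_sq]) auto
  have "(\<integral>x. (norm (U x))\<^sup>2 \<partial>M) \<le> (\<integral>x. (\<Sum>k=1..K. p k * (norm (V k x))\<^sup>2) \<partial>M)"
    using U_sq V_sq U_le by (rule integral_mono)
  also have "\<dots> = (\<Sum>k=1..K. p k * (\<integral>x. (norm (V k x))\<^sup>2 \<partial>M))"
    using device by simp
  also have "\<dots> \<le> (\<Sum>k=1..K. p k * update_bound \<sigma> \<theta> G)"
    using device p0 by (intro sum_mono mult_left_mono) auto
  also have "\<dots> = update_bound \<sigma> \<theta> G"
    using p1 by (simp add: sum_distrib_right[symmetric])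
  finally have U_sq_le: "(\<integral>x. (norm (U x))\<^sup>2 \<partial>M) \<le> update_bound \<sigma> \<theta> G" .
  have F_w: "integrable M (\<lambda>x. F (w x))"
    using w(1,2) finite_measure_axioms by (rule integrable_loss)
  have F_w': "integrable M (\<lambda>x. F (w' x))"
    using w' w'_sq finite_measure_axioms by (rule integrable_loss)
  have "(\<integral>x. F (w' x) \<partial>M)
      \<le> (\<integral>x. F (w x) - \<eta> * (U x \<bullet> g (w x)) + L / 2 * \<eta>\<^sup>2 * (norm (U x))\<^sup>2 \<partial>M)"
  proof (rule integral_mono[OF F_w'])
    show "integrable M (\<lambda>x. F (w x) - \<eta> * (U x \<bullet> g (w x)) + L / 2 * \<eta>\<^sup>2 * (norm (U x))\<^sup>2)"
      using F_w Ug U_sq by auto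
    show "F (w' x) \<le> F (w x) - \<eta> * (U x \<bullet> g (w x)) + L / 2 * \<eta>\<^sup>2 * (norm (U x))\<^sup>2"
      if "x \<in> space M" for x
      using smooth[of "w' x" "w x"] step'[OF that] by (simp add: power_mult_distrib mult_ac)
  qed
  also have "\<dots> = (\<integral>x. F (w x) \<partial>M) - \<eta> * (\<integral>x. (norm (g (w x)))\<^sup>2 \<partial>M)
      + L / 2 * \<eta>\<^sup>2 * (\<integral>x. (norm (U x))\<^sup>2 \<partial>M)"
    using F_w Ug U_sq by (simp add: Ug_eq)
  also have "\<dots> \<le> (\<integral>x. F (w x) \<partial>M) - \<eta> * (\<integral>x. (norm (g (w x)))\<^sup>2 \<partial>M)
      + L / 2 * \<eta>\<^sup>2 * update_bound \<sigma> \<theta> G"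
    using U_sq_le L_pos by (intro add_left_mono mult_left_mono) auto
  finally show "(\<integral>x. F (w' x) \<partial>M) \<le> (\<integral>x. F (w x) \<partial>M) - \<eta> * (\<integral>x. (norm (g (w x)))\<^sup>2 \<partial>M)
      + L / 2 * \<eta>\<^sup>2 * update_bound \<sigma> \<theta> G" .
qed

section \<open>Telescoping over a run with a fixed number of rounds\<close>

context
  fixes M :: "'a measure" and K T :: nat and D :: "nat \<Rightarrow> nat" and \<gamma> :: "nat \<Rightarrow> nat \<Rightarrow> real"
    and w :: "nat \<Rightarrow> 'a \<Rightarrow> real ^ 'd" and m sg :: "nat \<Rightarrow> nat \<Rightarrow> 'a \<Rightarrow> real ^ 'd"
    and w0 :: "real ^ 'd" and G \<sigma> \<theta> \<eta> :: real
  assumes K: "K \<ge> 1" and D: "\<And>k. k \<in> {1..K} \<Longrightarrow> D k \<ge> 1"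
    and \<gamma>: "\<And>k t. t < T \<Longrightarrow> k \<in> {1..K} \<Longrightarrow> \<gamma> k t \<in> {0..<\<theta>}" and \<theta>: "\<theta> < 1"
    and run: "feddrop_run M T \<eta> g H \<sigma> K D \<gamma> w0 w m sg"
    and w_sq: "\<And>t. t \<le> T \<Longrightarrow> integrable M (\<lambda>x. (norm (w t x))\<^sup>2)"
    and w_le: "\<And>t. t \<le> T \<Longrightarrow> (\<integral>x. (norm (w t x))\<^sup>2 \<partial>M) \<le> G\<^sup>2"
begin

lemma run_prob_space: "prob_space M"
  using run by (simp add: feddrop_run_def)

lemma run_round:
  assumes "t < T" "w t \<in> borel_measurable M"
  shows "w (Suc t) \<in> borel_measurable M"
    and "(\<integral>x. F (w (Suc t) x) \<partial>M) \<le> (\<integral>x. F (w t x) \<partial>M) - \<eta> * (\<integral>x. (norm (g (w t x)))\<^sup>2 \<partial>M)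
      + L / 2 * \<eta>\<^sup>2 * update_bound \<sigma> \<theta> G"
proof -
  have fresh: "\<And>k. k \<in> {1..K} \<Longrightarrow> dropout_mask M (sigma_rv M (w t)) (\<gamma> k t) (m k t)"
    "stochastic_gradients M (sigma_rv M (w t)) g \<sigma> K D (w t) (\<lambda>k. sg k t)"
    and step: "\<And>x. x \<in> space M \<Longrightarrow> w (Suc t) x = w t x - \<eta> *\<^sub>R
      (\<Sum>k=1..K. (real (D k) / real (\<Sum>j=1..K. D j)) *\<^sub>R
        subnet_gradient H (w t x) (m k t x) (sg k t x))"
    using run assms(1) unfolding feddrop_run_def fresh_draws_def Let_def by blast+
  have t: "t \<le> T" "Suc t \<le> T" using assms(1) by auto
  note round = round_descent[OF run_prob_space K D assms(2) w_sq[OF t(1)] w_le[OF t(1)]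
      w_sq[OF t(2)] \<gamma>[OF assms(1)] \<theta> fresh step]
  show "w (Suc t) \<in> borel_measurable M" by (rule round(1))
  show "(\<integral>x. F (w (Suc t) x) \<partial>M) \<le> (\<integral>x. F (w t x) \<partial>M) - \<eta> * (\<integral>x. (norm (g (w t x)))\<^sup>2 \<partial>M)
      + L / 2 * \<eta>\<^sup>2 * update_bound \<sigma> \<theta> G"
    by (rule round(2))
qed

text \<open>A run prescribes measurable masks and stochastic gradients but says nothing direct about
  the iterates; measurability spreads from the constant start through the update rule.\<close>

lemma iterate_measurable: "t \<le> T \<Longrightarrow> w t \<in> borel_measurable M"
proof (induction t)
  case 0
  have "w 0 \<in> borel_measurable M \<longleftrightarrow> (\<lambda>_. w0) \<in> borel_measurable M"
    using run by (intro measurable_cong) (simp add: feddrop_run_def)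
  then show ?case by simp
next
  case (Suc t)
  then show ?case by (intro run_round) auto
qed

lemma run_integrable_gradient_sq:
  assumes "t \<le> T"
  shows "integrable M (\<lambda>x. (norm (g (w t x)))\<^sup>2)"
  using iterate_measurable[OF assms] w_sq[OF assms] prob_space.finite_measure[OF run_prob_space]
  by (rule integrable_gradient_sq)

lemma sum_expected_gradient_sq_le:
  "\<eta> * (\<Sum>t<T. \<integral>x. (norm (g (w t x)))\<^sup>2 \<partial>M)
    \<le> F w0 - Fstar + real T * (L / 2 * \<eta>\<^sup>2 * update_bound \<sigma> \<theta> G)"
proof -
  interpret prob_space M by (rule run_prob_space)
  \<comment> \<open>Stated for every \<open>n \<le> T\<close> so that induction applies; each round
    adds one descent inequality.\<close>
  have telescope: "\<eta> * (\<Sum>t<n. \<integral>x. (norm (g (w t x)))\<^sup>2 \<partial>M) \<le> (\<integral>x. F (w 0 x) \<partial>M) - (\<integral>x. F (w n x) \<partial>M)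
      + real n * (L / 2 * \<eta>\<^sup>2 * update_bound \<sigma> \<theta> G)" if "n \<le> T" for n
    using that
  proof (induction n)
    case (Suc n)
    then have "n < T" "n \<le> T" by auto
    with Suc.IH run_round(2)[OF _ iterate_measurable, of n]
    show ?case by (simp add: distrib_left distrib_right add_divide_distrib)
  qed simp
  have "(\<integral>x. F (w 0 x) \<partial>M) = F w0"
  proof -
    have "(\<integral>x. F (w 0 x) \<partial>M) = (\<integral>x. F w0 \<partial>M)"
      using run by (intro Bochner_Integration.integral_cong) (auto simp: feddrop_run_def)
    then show ?thesis by (simp add: prob_space)
  qed
  \<comment> \<open>The iterate after the last round appears here, which is why the moment bounds
    reach \<open>t = T\<close>.\<close>
  moreover have "Fstar \<le> (\<integral>x. F (w T x) \<partial>M)"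
  proof -
    have "integrable M (\<lambda>x. F (w T x))"
      using iterate_measurable w_sq finite_measure_axioms by (intro integrable_loss) auto
    then have "(\<integral>x. Fstar \<partial>M) \<le> (\<integral>x. F (w T x) \<partial>M)"
      using lower_bound by (intro integral_mono) auto
    then show ?thesis by (simp add: prob_space)
  qed
  ultimately show ?thesis using telescope[of T] by simp
qed

lemma average_expected_gradient_sq_le:
  assumes T: "T \<ge> 1" and \<eta>: "\<eta> = 1 / (3 * sqrt (real T) * L)"
  shows "1 / real T * (\<Sum>t<T. \<integral>x. (norm (g (w t x)))\<^sup>2 \<partial>M)
    \<le> (3 * L * (F w0 - Fstar) + update_bound \<sigma> \<theta> G / 6) / sqrt (real T)"
proof -
  let ?S = "\<Sum>t<T. \<integral>x. (norm (g (w t x)))\<^sup>2 \<partial>M" and ?C = "update_bound \<sigma> \<theta> G"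
  define s where "s = sqrt (real T)"
  have s: "s > 0" "real T = s\<^sup>2" using T by (auto simp: s_def)
  \<comment> \<open>The factor \<open>3 * s * L\<close> is the inverse of the learning rate. With
    \<open>s\<^sup>2 * \<eta>\<^sup>2 = 1 / (9 * L\<^sup>2)\<close> the quadratic term becomes
    \<open>s * ?C / 6\<close>.\<close>
  have "(3 * s * L) * (\<eta> * ?S) \<le> (3 * s * L) * (F w0 - Fstar + s\<^sup>2 * (L / 2 * \<eta>\<^sup>2 * ?C))"
    using sum_expected_gradient_sq_le s L_pos by (intro mult_left_mono) auto
  also have "(3 * s * L) * (\<eta> * ?S) = ?S"
    using s L_pos by (simp add: \<eta> s_def[symmetric])
  also have "(3 * s * L) * (F w0 - Fstar + s\<^sup>2 * (L / 2 * \<eta>\<^sup>2 * ?C))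
      = s * (3 * L * (F w0 - Fstar) + ?C / 6)"
    using s L_pos by (simp add: \<eta> s_def[symmetric] field_simps power2_eq_square)
  finally have "?S / s\<^sup>2 \<le> s * (3 * L * (F w0 - Fstar) + ?C / 6) / s\<^sup>2"
    by (rule divide_right_mono) simp
  also have "\<dots> = (3 * L * (F w0 - Fstar) + ?C / 6) / s"
    using s by (simp add: power2_eq_square)
  finally show ?thesis by (simp add: s(2)[symmetric] s_def)
qed

end

end

section \<open>Passage to the limit\<close>

lemma tendsto_zero_of_abs_le_inverse_sqrt:
  fixes f :: "nat \<Rightarrow> real"
  assumes "\<And>T. T \<ge> 1 \<Longrightarrow> \<bar>f T\<bar> \<le> c / sqrt (real T)"
  shows "f \<longlonglongrightarrow> 0"
proof (rule Lim_null_comparison)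
  show "\<forall>\<^sub>F T in sequentially. norm (f T) \<le> c / sqrt (real T)"
    using assms by (auto intro!: eventually_sequentiallyI[of 1])
  show "(\<lambda>T. c / sqrt (real T)) \<longlonglongrightarrow> 0"
    by (intro tendsto_divide_0[OF tendsto_const] filterlim_at_top_imp_at_infinity
        filterlim_compose[OF sqrt_at_top] filterlim_real_sequentially)
qed

text \<open>Each ratio has numerator at most \<open>1\<close> and denominator at least
  \<open>1 - \<theta>\<close>, and averaging over devices and rounds keeps this bound. Hence the
  bracket in \<open>G_T\<close> stays bounded as \<open>T\<close> grows.\<close>

lemma weighted_dropout_average_bounds:
  fixes \<gamma> :: "nat \<Rightarrow> nat \<Rightarrow> real" and D :: "nat \<Rightarrow> nat"
  assumes "\<theta> < 1" and \<gamma>: "\<And>t k. t < T \<Longrightarrow> k \<in> {1..K} \<Longrightarrow> \<gamma> k t \<in> {0..<\<theta>}" and "T \<ge> 1"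
  defines "W \<equiv> (\<Sum>t<T. \<Sum>k=1..K. real (D k) / real (\<Sum>j=1..K. D j) * (\<gamma> k t / (1 - \<gamma> k t)))"
  shows "0 \<le> W" "W / real T \<le> 1 / (1 - \<theta>)"
proof -
  have r: "0 \<le> \<gamma> k t / (1 - \<gamma> k t)" "\<gamma> k t / (1 - \<gamma> k t) \<le> 1 / (1 - \<theta>)"
    if "t < T" "k \<in> {1..K}" for k t
    using \<gamma>[OF that] \<open>\<theta> < 1\<close> by (auto intro!: frac_le)
  show "0 \<le> W"
    unfolding W_def using r
    by (intro sum_nonneg mult_nonneg_nonneg) (auto simp del: of_nat_sum)
  have "W \<le> (\<Sum>t<T. \<Sum>k=1..K. real (D k) / real (\<Sum>j=1..K. D j) * (1 / (1 - \<theta>)))"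
    unfolding W_def using r
    by (intro sum_mono mult_left_mono) (auto simp del: of_nat_sum)
  also have "\<dots> = real T * ((\<Sum>k=1..K. real (D k) / real (\<Sum>j=1..K. D j)) * (1 / (1 - \<theta>)))"
    by (simp only: sum_constant card_lessThan sum_distrib_right)
  \<comment> \<open>The weights sum to a quotient of a number by itself, which is \<open>1\<close>,
    or \<open>0\<close> under division by zero; either way at most \<open>1\<close>.\<close>
  also have "\<dots> \<le> real T * (1 * (1 / (1 - \<theta>)))"
    using \<open>\<theta> < 1\<close> unfolding sum_divide_distrib[symmetric] of_nat_sum[symmetric]
    by (intro mult_left_mono mult_right_mono) (auto simp del: of_nat_sum)
  finally show "W / real T \<le> 1 / (1 - \<theta>)"
    using \<open>T \<ge> 1\<close> by (simp add: pos_divide_le_eq mult.commute)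
qed

theorem theorem1:
  fixes F :: "real ^ 'd \<Rightarrow> real"
    and g :: "real ^ 'd \<Rightarrow> real ^ 'd"
    and H :: "real ^ 'd \<Rightarrow> real ^ 'd ^ 'd"
    and K :: nat and D :: "nat \<Rightarrow> nat"
    and L A G \<sigma> Fstar \<theta> :: real
    and w0 :: "real ^ 'd"
    and M :: "nat \<Rightarrow> 'a measure"
    and \<gamma> :: "nat \<Rightarrow> nat \<Rightarrow> nat \<Rightarrow> real"
    and w :: "nat \<Rightarrow> nat \<Rightarrow> 'a \<Rightarrow> real ^ 'd"
    and m sg :: "nat \<Rightarrow> nat \<Rightarrow> nat \<Rightarrow> 'a \<Rightarrow> real ^ 'd"
  assumes "K \<ge> 1"
    and "\<And>k. k \<in> {1..K} \<Longrightarrow> D k \<ge> 1"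
    and gradient: "\<And>v. GDERIV F v :> g v"
    and hessian: "\<And>v. (g has_derivative (\<lambda>h. H v *v h)) (at v)"
    and "\<theta> < 1"
    and rates: "\<And>T t k. T \<ge> 1 \<Longrightarrow> t < T \<Longrightarrow> k \<in> {1..K} \<Longrightarrow> \<gamma> T k t \<in> {0..<\<theta>}"
    and run: "\<And>T. T \<ge> 1 \<Longrightarrow>
                feddrop_run (M T) T (1 / (3 * sqrt (real T) * L)) g H \<sigma> K D (\<gamma> T) w0 (w T) (m T) (sg T)"
    and hessian_bound: "\<And>v. (frobenius_norm (H v))\<^sup>2 \<le> A\<^sup>2"
    and iterate_bound: "\<And>T t. T \<ge> 1 \<Longrightarrow> t \<le> T \<Longrightarrow>
                integrable (M T) (\<lambda>x. (norm (w T t x))\<^sup>2) \<and>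
                (\<integral>x. (norm (w T t x))\<^sup>2 \<partial>M T) \<le> G\<^sup>2"
    and lower_bound: "\<And>v. F v \<ge> Fstar"
    and "L > 0"
    and smooth: "\<And>u v. F v \<le> F u + (v - u) \<bullet> g u + L / 2 * (norm (v - u))\<^sup>2"
  shows "(\<forall>T\<ge>1. \<forall>t<T. integrable (M T) (\<lambda>x. (norm (g (w T t x)))\<^sup>2)) \<and>
    (\<exists>l G_T :: real.
       (\<lambda>T. 1 / real T * (\<Sum>t<T. \<integral>x. (norm (g (w T t x)))\<^sup>2 \<partial>M T)) \<longlonglongrightarrow> l \<and>
       (\<lambda>T. 1 / sqrt (real T) *
              (9 * L * (F w0 - Fstar) + 2 * real K * (\<sigma>\<^sup>2 / real (\<Sum>j=1..K. D j))
               + A\<^sup>2 * G\<^sup>2 / real T *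
                 (\<Sum>t<T. \<Sum>k=1..K. real (D k) / real (\<Sum>j=1..K. D j)
                                       * (\<gamma> T k t / (1 - \<gamma> T k t))))) \<longlonglongrightarrow> G_T \<and>
       l \<le> G_T \<and> G_T = 0)"
proof -
  interpret smooth_loss F g H A L Fstar
    by unfold_locales (fact assms)+
  let ?p = "\<lambda>k. real (D k) / real (\<Sum>j=1..K. D j)"
  let ?avg = "\<lambda>T. 1 / real T * (\<Sum>t<T. \<integral>x. (norm (g (w T t x)))\<^sup>2 \<partial>M T)"
  let ?W = "\<lambda>T. \<Sum>t<T. \<Sum>k=1..K. ?p k * (\<gamma> T k t / (1 - \<gamma> T k t))"
  let ?b = "9 * L * (F w0 - Fstar) + 2 * real K * (\<sigma>\<^sup>2 / real (\<Sum>j=1..K. D j))"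
  let ?G = "\<lambda>T. 1 / sqrt (real T) * (?b + A\<^sup>2 * G\<^sup>2 / real T * ?W T)"
  have sq: "t \<le> T \<Longrightarrow> integrable (M T) (\<lambda>x. (norm (w T t x))\<^sup>2)"
    and sq_le: "t \<le> T \<Longrightarrow> (\<integral>x. (norm (w T t x))\<^sup>2 \<partial>M T) \<le> G\<^sup>2" if "T \<ge> 1" for T t
    using iterate_bound[OF that] by auto
  \<comment> \<open>Since a nonintegrable function has Bochner integral \<open>0\<close>, this
    conjunct certifies that the averaged expectations are genuine.\<close>
  have "integrable (M T) (\<lambda>x. (norm (g (w T t x)))\<^sup>2)" if "T \<ge> 1" "t < T" for T t
    using run_integrable_gradient_sq[OF assms(1,2) rates[OF that(1)] assms(5) run[OF that(1)]
        sq[OF that(1)] sq_le[OF that(1)]] that(2) by simp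
  moreover have "?avg \<longlonglongrightarrow> 0"
  proof (rule tendsto_zero_of_abs_le_inverse_sqrt)
    fix T :: nat assume T: "T \<ge> 1"
    have "0 \<le> ?avg T"
      by (intro mult_nonneg_nonneg sum_nonneg Bochner_Integration.integral_nonneg) auto
    \<comment> \<open>The numerator involves only quantities fixed before \<open>T\<close>, so the
      average is squeezed between \<open>0\<close> and a multiple of
      \<open>1 / sqrt (real T)\<close>.\<close>
    then show "\<bar>?avg T\<bar> \<le> (3 * L * (F w0 - Fstar) + update_bound \<sigma> \<theta> G / 6) / sqrt (real T)"
      using average_expected_gradient_sq_le[OF assms(1,2) rates[OF T] assms(5) run[OF T]
          sq[OF T] sq_le[OF T] T refl] by linarith
  qed
  moreover have "?G \<longlonglongrightarrow> 0"
  proof (rule tendsto_zero_of_abs_le_inverse_sqrt)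
    fix T :: nat assume T: "T \<ge> 1"
    have W: "0 \<le> ?W T" "?W T / real T \<le> 1 / (1 - \<theta>)"
      using weighted_dropout_average_bounds[OF assms(5) rates[OF T] T] by auto
    \<comment> \<open>Nonnegativity, from \<open>Fstar \<le> F w0\<close>, removes the absolute
      value and leaves only an upper bound to find.\<close>
    have "0 \<le> ?b"
      using lower_bound[of w0] L_pos
      by (intro add_nonneg_nonneg mult_nonneg_nonneg) (auto simp del: of_nat_sum)
    moreover have "0 \<le> A\<^sup>2 * G\<^sup>2 / real T * ?W T"
      using W(1) by (intro mult_nonneg_nonneg) auto
    moreover have "A\<^sup>2 * G\<^sup>2 / real T * ?W T \<le> A\<^sup>2 * G\<^sup>2 * (1 / (1 - \<theta>))"
      using mult_left_mono[OF W(2), of "A\<^sup>2 * G\<^sup>2"] by simp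
    ultimately have "\<bar>?b + A\<^sup>2 * G\<^sup>2 / real T * ?W T\<bar> \<le> ?b + A\<^sup>2 * G\<^sup>2 * (1 / (1 - \<theta>))"
      by linarith
    from divide_right_mono[OF this, of "sqrt (real T)"]
    show "\<bar>?G T\<bar> \<le> (?b + A\<^sup>2 * G\<^sup>2 * (1 / (1 - \<theta>))) / sqrt (real T)"
      by (simp add: abs_mult)
  qed
  ultimately show ?thesis by blast
qed

end
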